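(* Let $G=(V,E)$ be an infinite, connected, locally finite, weighted graph and let $q\in[1,\infty)$. Let $f:V\to\mathbb{R}$ satisfy $\sum_{x\in V}|f(x)|^q\mu_x<\infty$. If $f$ is harmonic, or if $f$ is nonnegative and subharmonic, then $f$ is constant.
   Context: A weighted graph $G=(V,E)$ is a graph with vertex set $V$ and (undirected) edge set $E$, with symmetric edge weights $\mu_{xy}=\mu_{yx}>0$ for $xy\in E$, extended by $\mu_{xy}=0$ for $xy\notin E$. Self-loops ($xx\in E$, i.e. $\mu_{xx}>0$) are allowed, multiple edges are not. Locally finite means every vertex has finitely many neighbors. The vertex weight is $\mu_x=\sum_{y}\mu_{xy}$; no uniform upper or lower bound on $\mu_x$ is assumed. The normalized Laplace operator is $\Delta f(x)=\frac{1}{\mu_x}\sum_{y}\mu_{xy}(f(y)-f(x))$ for $f:V\to\mathbb{R}$; $f$ is harmonic (respectively subharmonic) if $\Delta f(x)=0$ (respectively $\Delta f(x)\ge 0$) for all $x\in V$. *)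

theory Defs
  imports "HOL-Analysis.Analysis"
begin

(* An undirected edge xy is the set {x, y}; a self-loop at x is {x, x} = {x}. *)
locale weighted_graph =
  fixes V :: "'a set" and E :: "'a set set" and \<mu> :: "'a \<Rightarrow> 'a \<Rightarrow> real"
  assumes edges_in_vertices: "E \<subseteq> {{x, y} |x y. x \<in> V \<and> y \<in> V}"
    and weight_sym: "\<mu> x y = \<mu> y x"
    and weight_pos: "{x, y} \<in> E \<Longrightarrow> \<mu> x y > 0"
    and weight_zero: "{x, y} \<notin> E \<Longrightarrow> \<mu> x y = 0"

definition neighbours :: "'a set set \<Rightarrow> 'a \<Rightarrow> 'a set" where
  "neighbours E x = {y. {x, y} \<in> E}"

definition locally_finite_graph :: "'a set \<Rightarrow> 'a set set \<Rightarrow> bool" where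
  "locally_finite_graph V E \<longleftrightarrow> (\<forall>x\<in>V. finite (neighbours E x))"

definition connected_graph :: "'a set \<Rightarrow> 'a set set \<Rightarrow> bool" where
  "connected_graph V E \<longleftrightarrow> (\<forall>x\<in>V. \<forall>y\<in>V. (x, y) \<in> {(u, v). {u, v} \<in> E}\<^sup>*)"

(* The sums over y are taken over the neighbours of x, a finite set in a locally finite
   graph; all other terms vanish because \<mu> x y = 0 off the edges. *)
definition vertex_weight :: "'a set set \<Rightarrow> ('a \<Rightarrow> 'a \<Rightarrow> real) \<Rightarrow> 'a \<Rightarrow> real" where
  "vertex_weight E \<mu> x = (\<Sum>y\<in>neighbours E x. \<mu> x y)"

definition laplacian ::
    "'a set set \<Rightarrow> ('a \<Rightarrow> 'a \<Rightarrow> real) \<Rightarrow> ('a \<Rightarrow> real) \<Rightarrow> 'a \<Rightarrow> real" where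
  "laplacian E \<mu> f x =
     1 / vertex_weight E \<mu> x * (\<Sum>y\<in>neighbours E x. \<mu> x y * (f y - f x))"

definition harmonic_on_graph ::
    "'a set \<Rightarrow> 'a set set \<Rightarrow> ('a \<Rightarrow> 'a \<Rightarrow> real) \<Rightarrow> ('a \<Rightarrow> real) \<Rightarrow> bool" where
  "harmonic_on_graph V E \<mu> f \<longleftrightarrow> (\<forall>x\<in>V. laplacian E \<mu> f x = 0)"

definition subharmonic_on_graph ::
    "'a set \<Rightarrow> 'a set set \<Rightarrow> ('a \<Rightarrow> 'a \<Rightarrow> real) \<Rightarrow> ('a \<Rightarrow> real) \<Rightarrow> bool" where
  "subharmonic_on_graph V E \<mu> f \<longleftrightarrow> (\<forall>x\<in>V. laplacian E \<mu> f x \<ge> 0)"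

end

theory Submission
  imports Defs
begin

text \<open>
  Everything reduces to nonnegative subharmonic functions \<open>g\<close> with \<open>\<Sum> g \<mu> < \<infinity>\<close>, that is, to the
  case \<open>q = 1\<close>. Convex nondecreasing functions preserve subharmonicity (lemma
  \<open>subharmonic_compose_convex\<close>, which is Jensen's inequality for the mean over the neighbours).
  Hence a nonnegative subharmonic \<open>f\<close> in \<open>\<ell>\<^sup>q(\<mu>)\<close> gives the nonnegative subharmonic \<open>f\<^sup>q\<close> in
  \<open>\<ell>\<^sup>1(\<mu>)\<close>, and for harmonic \<open>f\<close> the positive parts of \<open>f\<close> and of \<open>-f\<close> are nonnegative and
  subharmonic, and their difference is \<open>f\<close>.

  In \<open>\<ell>\<^sup>1(\<mu>)\<close> a nonnegative subharmonic \<open>g\<close> is harmonic (lemma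
  \<open>summable_subharmonic_imp_harmonic\<close>): by symmetry of the weights, averaging over neighbours
  preserves the total mass \<open>\<Sum> g \<mu>\<close>, so the nonnegative terms \<open>\<mu>\<^sub>x \<Delta>g(x)\<close> have sum \<open>0\<close>.
  Because the class of these functions is also closed under truncation, this applies to
  \<open>h = max (g - g(x\<^sub>0)) 0\<close> for every vertex \<open>x\<^sub>0\<close>. Now \<open>h\<close> is a nonnegative harmonic function
  with a zero at \<open>x\<^sub>0\<close>, so the minimum principle forces \<open>h = 0\<close>, which says \<open>g \<le> g(x\<^sub>0)\<close>
  everywhere. As \<open>x\<^sub>0\<close> is arbitrary, \<open>g\<close> is constant.
\<close>

section \<open>Convex functions of subharmonic functions\<close>

text \<open>
  The point \<open>0\<close> has to be included because the functions to which the power is applied may vanish;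
  at \<open>0\<close> the convexity inequality reads \<open>t powr q \<le> t\<close> for \<open>t\<close> in the unit interval.
\<close>

lemma convex_on_powr_atLeast_0:
  fixes q :: real
  assumes "q \<ge> 1"
  shows "convex_on {0..} (\<lambda>t. t powr q)"
proof (rule convex_onI)
  fix t x y :: real
  assume t: "0 < t" "t < 1" and xy: "x \<in> {0..}" "y \<in> {0..}"
  have scale: "(s * z) powr q \<le> s * z powr q" if "0 < s" "s < 1" "z \<ge> 0" for s z :: real
  proof -
    have "s powr q \<le> s powr 1"
      using that assms by (intro powr_mono') auto
    then show ?thesis
      using that by (simp add: powr_mult mult_right_mono)
  qed
  show "((1 - t) *\<^sub>R x + t *\<^sub>R y) powr q \<le> (1 - t) * x powr q + t * y powr q"
  proof (cases "x = 0 \<or> y = 0")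
    case True
    then show ?thesis
      using scale[of t y] scale[of "1 - t" x] t xy by auto
  next
    case False
    then show ?thesis
      using convex_onD[OF powr_convex[OF assms], of t x y] t xy by simp
  qed
qed simp

locale locally_finite_weighted_graph = weighted_graph +
  assumes locally_finite: "locally_finite_graph V E"
begin

lemma finite_neighbours: "x \<in> V \<Longrightarrow> finite (neighbours E x)"
  using locally_finite by (simp add: locally_finite_graph_def)

lemma neighbour_in_V: "y \<in> neighbours E x \<Longrightarrow> y \<in> V"
  using edges_in_vertices by (fastforce simp: neighbours_def doubleton_eq_iff)

lemma neighbours_sym: "y \<in> neighbours E x \<longleftrightarrow> x \<in> neighbours E y"
  by (simp add: neighbours_def insert_commute)

lemma weight_neighbour_pos: "y \<in> neighbours E x \<Longrightarrow> \<mu> x y > 0"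
  by (simp add: neighbours_def weight_pos)

lemma vertex_weight_nonneg: "vertex_weight E \<mu> x \<ge> 0"
  unfolding vertex_weight_def by (intro sum_nonneg) (simp add: less_imp_le weight_neighbour_pos)

lemma vertex_weight_pos: "x \<in> V \<Longrightarrow> neighbours E x \<noteq> {} \<Longrightarrow> vertex_weight E \<mu> x > 0"
  unfolding vertex_weight_def by (intro sum_pos finite_neighbours weight_neighbour_pos)

text \<open>
  Multiplied by the vertex weight, the Laplacian compares the weighted sum over the neighbours with
  the value at the vertex. This also holds at isolated vertices, where both sides vanish.
\<close>

lemma vertex_weight_times_laplacian:
  assumes "x \<in> V"
  shows "vertex_weight E \<mu> x * laplacian E \<mu> f x
       = (\<Sum>y\<in>neighbours E x. \<mu> x y * f y) - f x * vertex_weight E \<mu> x"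
proof (cases "neighbours E x = {}")
  case True
  then show ?thesis by (simp add: vertex_weight_def)
next
  case False
  then have "vertex_weight E \<mu> x * laplacian E \<mu> f x = (\<Sum>y\<in>neighbours E x. \<mu> x y * (f y - f x))"
    using vertex_weight_pos[OF assms] by (simp add: laplacian_def)
  also have "\<dots> = (\<Sum>y\<in>neighbours E x. \<mu> x y * f y) - f x * vertex_weight E \<mu> x"
    by (simp add: vertex_weight_def right_diff_distrib sum_subtractf sum_distrib_left mult.commute)
  finally show ?thesis .
qed

text \<open>
  At a vertex that has neighbours, the value of \<open>f\<close> is at most a convex combination of its values
  there; apply the nondecreasing \<open>\<phi>\<close> to this inequality and then Jensen's inequality.
\<close>

lemma subharmonic_compose_convex:
  fixes \<phi> :: "real \<Rightarrow> real"
  assumes sub: "subharmonic_on_graph V E \<mu> f"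
    and range: "f ` V \<subseteq> S"
    and convex: "convex_on S \<phi>"
    and mono: "mono_on S \<phi>"
  shows "subharmonic_on_graph V E \<mu> (\<lambda>x. \<phi> (f x))"
  unfolding subharmonic_on_graph_def
proof
  fix x assume x: "x \<in> V"
  show "laplacian E \<mu> (\<lambda>x. \<phi> (f x)) x \<ge> 0"
  proof (cases "neighbours E x = {}")
    case True
    then show ?thesis by (simp add: laplacian_def)
  next
    case False
    let ?N = "neighbours E x" and ?m = "vertex_weight E \<mu> x"
    define a where "a y = \<mu> x y / ?m" for y
    have m: "?m > 0"
      using vertex_weight_pos[OF x False] .
    have a1: "sum a ?N = 1"
      using m by (simp add: a_def vertex_weight_def flip: sum_divide_distrib)
    have a0: "a y \<ge> 0" if "y \<in> ?N" for y
      using that m by (simp add: a_def less_imp_le weight_neighbour_pos)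
    have fS: "f y \<in> S" if "y \<in> ?N" for y
      using that range neighbour_in_V by blast
    have mean: "(\<Sum>y\<in>?N. \<mu> x y * g y) = ?m * (\<Sum>y\<in>?N. a y * g y)" for g :: "'a \<Rightarrow> real"
      using m by (simp add: a_def sum_distrib_left)
    have "?m * laplacian E \<mu> f x \<ge> 0"
      using sub x m by (simp add: subharmonic_on_graph_def)
    then have "f x * ?m \<le> ?m * (\<Sum>y\<in>?N. a y * f y)"
      unfolding vertex_weight_times_laplacian[OF x] mean by simp
    then have le: "f x \<le> (\<Sum>y\<in>?N. a y * f y)"
      using m by (simp add: mult.commute[of "f x"])
    have "(\<Sum>y\<in>?N. a y *\<^sub>R f y) \<in> S"
      using convex_on_imp_convex[OF convex] by (intro convex_sum finite_neighbours x a1 a0 fS)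
    then have "\<phi> (f x) \<le> \<phi> (\<Sum>y\<in>?N. a y *\<^sub>R f y)"
      using le range x by (intro mono_onD[OF mono]) auto
    also have "\<dots> \<le> (\<Sum>y\<in>?N. a y * \<phi> (f y))"
      by (rule convex_on_sum[OF finite_neighbours[OF x] False convex a1 a0 fS])
    finally have "?m * \<phi> (f x) \<le> (\<Sum>y\<in>?N. \<mu> x y * \<phi> (f y))"
      using m by (simp add: mean)
    then have "?m * laplacian E \<mu> (\<lambda>x. \<phi> (f x)) x \<ge> 0"
      by (simp add: vertex_weight_times_laplacian[OF x] mult.commute)
    then show ?thesis
      using m by (simp add: zero_le_mult_iff)
  qed
qed

lemma subharmonic_truncation:
  assumes "subharmonic_on_graph V E \<mu> f"
  shows "subharmonic_on_graph V E \<mu> (\<lambda>x. max (f x - c) 0)"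
proof (rule subharmonic_compose_convex[OF assms])
  show "convex_on UNIV (\<lambda>t. max (t - c) 0)"
  proof (rule convex_onI)
    fix t x y :: real assume t: "0 < t" "t < 1"
    have "(1 - t) * x + t * y - c = (1 - t) * (x - c) + t * (y - c)"
      by (simp add: algebra_simps)
    also have "\<dots> \<le> (1 - t) * max (x - c) 0 + t * max (y - c) 0"
      using t by (intro add_mono mult_left_mono) auto
    moreover have "0 \<le> (1 - t) * max (x - c) 0 + t * max (y - c) 0"
      using t by simp
    ultimately show "max ((1 - t) *\<^sub>R x + t *\<^sub>R y - c) 0
        \<le> (1 - t) * max (x - c) 0 + t * max (y - c) 0"
      by simp
  qed simp
  show "mono_on UNIV (\<lambda>t. max (t - c) 0)"
    by (auto intro!: mono_onI)
qed simp

section \<open>Integrable subharmonic functions\<close>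

text \<open>
  Both sums below are sums over oriented edges \<open>(x, y)\<close>, of \<open>\<mu> x y * g x\<close> and of \<open>\<mu> x y * g y\<close>
  respectively; reversing the orientation exchanges them. Nonnegativity makes the double sum
  converge unconditionally.
\<close>

lemma neighbour_sums_preserve_mass:
  assumes nonneg: "\<And>x. x \<in> V \<Longrightarrow> g x \<ge> 0"
    and mass: "((\<lambda>x. g x * vertex_weight E \<mu> x) has_sum S) V"
  shows "((\<lambda>x. \<Sum>y\<in>neighbours E x. \<mu> x y * g y) has_sum S) V"
proof -
  let ?A = "Sigma V (neighbours E)"
  have inner: "((\<lambda>y. \<mu> x y * g x) has_sum g x * vertex_weight E \<mu> x) (neighbours E x)"
    if "x \<in> V" for x
    using has_sum_finite[OF finite_neighbours[OF that], of "\<lambda>y. \<mu> x y * g x"]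
    by (simp add: vertex_weight_def sum_distrib_left mult.commute)
  have "(\<lambda>(x, y). \<mu> x y * g x) summable_on ?A"
    using inner mass nonneg
    by (intro summable_on_SigmaI[where g = "\<lambda>x. g x * vertex_weight E \<mu> x"])
       (auto simp: summable_on_def less_imp_le weight_neighbour_pos)
  then have "((\<lambda>(x, y). \<mu> x y * g x) has_sum S) ?A"
    using inner mass by (intro has_sum_SigmaI) auto
  moreover have "bij_betw prod.swap ?A ?A"
    by (rule bij_betwI[where g = prod.swap])
       (auto intro: neighbour_in_V iffD1[OF neighbours_sym])
  ultimately have "((\<lambda>p. case prod.swap p of (x, y) \<Rightarrow> \<mu> x y * g x) has_sum S) ?A"
    by (simp only: has_sum_reindex_bij_betw)
  then show ?thesis
    by (rule has_sum_SigmaD)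
       (auto intro!: has_sum_finiteI finite_neighbours simp: weight_sym)
qed

lemma summable_subharmonic_imp_harmonic:
  assumes nonneg: "\<And>x. x \<in> V \<Longrightarrow> g x \<ge> 0"
    and summable: "(\<lambda>x. g x * vertex_weight E \<mu> x) summable_on V"
    and sub: "subharmonic_on_graph V E \<mu> g"
  shows "harmonic_on_graph V E \<mu> g"
  unfolding harmonic_on_graph_def
proof
  fix x assume x: "x \<in> V"
  let ?L = "\<lambda>x. vertex_weight E \<mu> x * laplacian E \<mu> g x"
  obtain S where S: "((\<lambda>x. g x * vertex_weight E \<mu> x) has_sum S) V"
    using summable by (auto simp: summable_on_def)
  have "((\<lambda>x. (\<Sum>y\<in>neighbours E x. \<mu> x y * g y) + - (g x * vertex_weight E \<mu> x))
          has_sum S + - S) V"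
    using S by (intro has_sum_add neighbour_sums_preserve_mass nonneg) (simp_all add: has_sum_uminus)
  then have "(?L has_sum S + - S) V"
    by (simp add: vertex_weight_times_laplacian cong: has_sum_cong)
  then have "?L x = 0"
    using sub x vertex_weight_nonneg
    by (intro nonneg_has_sum_le_0D[where A = V and a = "S + - S"]) (auto simp: subharmonic_on_graph_def)
  then show "laplacian E \<mu> g x = 0"
    \<comment> \<open>Where the vertex weight is zero, so is its reciprocal, and hence the Laplacian.\<close>
    by (auto simp: laplacian_def)
qed

text \<open>
  At a zero of \<open>h\<close> the weighted sum of the nonnegative neighbouring values is at most \<open>0\<close>, so they
  all vanish: the zero set is closed under passing to neighbours.
\<close>

lemma minimum_principle:
  assumes connected: "connected_graph V E"
    and nonneg: "\<And>x. x \<in> V \<Longrightarrow> h x \<ge> 0"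
    and super: "\<And>x. x \<in> V \<Longrightarrow> laplacian E \<mu> h x \<le> 0"
    and x0: "x0 \<in> V" "h x0 = 0"
    and x: "x \<in> V"
  shows "h x = 0"
proof -
  have zero_spreads: "h z = 0" if y: "y \<in> V" "h y = 0" and z: "z \<in> neighbours E y" for y z
  proof -
    let ?t = "\<lambda>z. \<mu> y z * h z"
    have "vertex_weight E \<mu> y * laplacian E \<mu> h y \<le> 0"
      using super[OF y(1)] vertex_weight_nonneg by (simp add: mult_nonneg_nonpos)
    then have "sum ?t (neighbours E y) \<le> 0"
      by (simp add: vertex_weight_times_laplacian y)
    moreover have t0: "?t z \<ge> 0" if "z \<in> neighbours E y" for z
      using that by (simp add: nonneg neighbour_in_V less_imp_le weight_neighbour_pos)
    ultimately have "sum ?t (neighbours E y) = 0"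
      by (meson antisym sum_nonneg)
    then have "?t z = 0"
      using t0 z finite_neighbours[OF y(1)] by (simp add: sum_nonneg_eq_0_iff)
    then show ?thesis
      using weight_neighbour_pos[OF z] by simp
  qed
  have "(x0, x) \<in> {(u, v). {u, v} \<in> E}\<^sup>*"
    using connected x0 x by (simp add: connected_graph_def)
  then have "x \<in> V \<and> h x = 0"
  proof (induction rule: rtrancl_induct)
    case base
    then show ?case using x0 by simp
  next
    case (step y z)
    then have "z \<in> neighbours E y"
      by (simp add: neighbours_def)
    then show ?case
      using step.IH zero_spreads neighbour_in_V by blast
  qed
  then show ?thesis ..
qed

text \<open>
  Truncating at the level \<open>g x0\<close> yields a nonnegative harmonic function that vanishes at \<open>x0\<close>, so
  every value \<open>g x0\<close> is the maximum of \<open>g\<close>.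
\<close>

lemma summable_subharmonic_constant:
  assumes connected: "connected_graph V E"
    and nonneg: "\<And>x. x \<in> V \<Longrightarrow> g x \<ge> 0"
    and summable: "(\<lambda>x. g x * vertex_weight E \<mu> x) summable_on V"
    and sub: "subharmonic_on_graph V E \<mu> g"
  shows "g constant_on V"
proof -
  have "g x \<le> g x0" if "x0 \<in> V" "x \<in> V" for x0 x
  proof -
    let ?h = "\<lambda>x. max (g x - g x0) 0"
    have "?h z * vertex_weight E \<mu> z \<le> g z * vertex_weight E \<mu> z" if "z \<in> V" for z
      using nonneg[OF \<open>x0 \<in> V\<close>] nonneg[OF that] vertex_weight_nonneg
      by (intro mult_right_mono) auto
    then have "(\<lambda>z. ?h z * vertex_weight E \<mu> z) summable_on V"
      using vertex_weight_nonneg by (intro summable_on_comparison_test[OF summable]) auto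
    then have "harmonic_on_graph V E \<mu> ?h"
      by (intro summable_subharmonic_imp_harmonic subharmonic_truncation sub) auto
    then have "?h x = 0"
      using minimum_principle[OF connected, of ?h x0 x] that
      by (simp add: harmonic_on_graph_def)
    then show ?thesis by simp
  qed
  then have "g x = g x0" if "x0 \<in> V" "x \<in> V" for x0 x
    using that by (simp add: antisym)
  then show ?thesis
    unfolding constant_on_def by blast
qed

section \<open>Liouville property for q-integrable functions\<close>

lemma powr_summable_subharmonic_constant:
  assumes connected: "connected_graph V E"
    and q: "q \<ge> 1"
    and nonneg: "\<And>x. x \<in> V \<Longrightarrow> f x \<ge> 0"
    and summable: "(\<lambda>x. f x powr q * vertex_weight E \<mu> x) summable_on V"
    and sub: "subharmonic_on_graph V E \<mu> f"
  shows "f constant_on V"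
proof -
  have "subharmonic_on_graph V E \<mu> (\<lambda>x. f x powr q)"
  proof (rule subharmonic_compose_convex[OF sub])
    show "convex_on {0..} (\<lambda>t. t powr q)"
      using q by (rule convex_on_powr_atLeast_0)
    show "mono_on {0..} (\<lambda>t. t powr q)"
      using q by (auto intro!: mono_onI powr_mono2)
  qed (use nonneg in auto)
  then have "(\<lambda>x. f x powr q) constant_on V"
    by (intro summable_subharmonic_constant connected summable) auto
  then obtain c where c: "f x powr q = c" if "x \<in> V" for x
    unfolding constant_on_def by blast
  have "f x = c powr (1 / q)" if "x \<in> V" for x
    using c[OF that] nonneg[OF that] q by (auto simp: powr_powr)
  then show ?thesis
    unfolding constant_on_def by blast
qed

lemma laplacian_uminus: "laplacian E \<mu> (\<lambda>x. - f x) x = - laplacian E \<mu> f x"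
proof -
  have "(\<Sum>y\<in>neighbours E x. \<mu> x y * (- f y - - f x))
      = - (\<Sum>y\<in>neighbours E x. \<mu> x y * (f y - f x))"
    by (simp add: algebra_simps flip: sum_negf)
  then show ?thesis
    unfolding laplacian_def by simp
qed

lemma powr_summable_harmonic_constant:
  assumes connected: "connected_graph V E"
    and q: "q \<ge> 1"
    and summable: "(\<lambda>x. \<bar>f x\<bar> powr q * vertex_weight E \<mu> x) summable_on V"
    and harm: "harmonic_on_graph V E \<mu> f"
  shows "f constant_on V"
proof -
  have pos_part: "(\<lambda>x. max (u x) 0) constant_on V"
    if "subharmonic_on_graph V E \<mu> u" and abs: "\<And>x. \<bar>u x\<bar> = \<bar>f x\<bar>" for u
  proof (rule powr_summable_subharmonic_constant[OF connected q])
    show "subharmonic_on_graph V E \<mu> (\<lambda>x. max (u x) 0)"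
      using subharmonic_truncation[OF that(1), of 0] by simp
    have "max (u x) 0 powr q \<le> \<bar>f x\<bar> powr q" for x
      using q abs[of x] by (intro powr_mono2) auto
    then show "(\<lambda>x. max (u x) 0 powr q * vertex_weight E \<mu> x) summable_on V"
      using vertex_weight_nonneg
      by (intro summable_on_comparison_test[OF summable]) (auto intro!: mult_right_mono)
  qed simp
  obtain a where a: "max (f x) 0 = a" if "x \<in> V" for x
    using pos_part[of f] harm
    by (auto simp: constant_on_def subharmonic_on_graph_def harmonic_on_graph_def)
  obtain b where b: "max (- f x) 0 = b" if "x \<in> V" for x
    using pos_part[of "\<lambda>x. - f x"] harm
    by (auto simp: constant_on_def subharmonic_on_graph_def harmonic_on_graph_def laplacian_uminus)
  have "f x = a - b" if "x \<in> V" for x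
    using a[OF that] b[OF that] by linarith
  then show ?thesis
    unfolding constant_on_def by blast
qed

end

theorem theorem1p2:
  fixes V :: "'a set" and E :: "'a set set" and \<mu> :: "'a \<Rightarrow> 'a \<Rightarrow> real"
    and q :: real and f :: "'a \<Rightarrow> real"
  assumes "weighted_graph V E \<mu>"
    and "infinite V"
    and "connected_graph V E"
    and "locally_finite_graph V E"
    and "q \<ge> 1"
    and "(\<lambda>x. \<bar>f x\<bar> powr q * vertex_weight E \<mu> x) summable_on V"
    and "harmonic_on_graph V E \<mu> f \<or>
         ((\<forall>x\<in>V. f x \<ge> 0) \<and> subharmonic_on_graph V E \<mu> f)"
  shows "f constant_on V"
proof -
  interpret locally_finite_weighted_graph V E \<mu>
    using assms(1,4)
    by (simp add: locally_finite_weighted_graph_def locally_finite_weighted_graph_axioms_def)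
  from assms(7) show ?thesis
  proof
    assume "harmonic_on_graph V E \<mu> f"
    then show ?thesis
      by (rule powr_summable_harmonic_constant[OF assms(3,5,6)])
  next
    assume f: "(\<forall>x\<in>V. f x \<ge> 0) \<and> subharmonic_on_graph V E \<mu> f"
    then have "(\<lambda>x. f x powr q * vertex_weight E \<mu> x) summable_on V"
      using assms(6) by (simp cong: summable_on_cong)
    then show ?thesis
      using f by (intro powr_summable_subharmonic_constant[OF assms(3,5)]) auto
  qed
qed

end
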